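(* For the 2-D Euler equations of gas dynamics with the invariant region $$\mathcal G=\Big\{\mathbf u=(\rho,\rho v_1,\rho v_2,E)^\top\in\mathbb R^4:\ \rho>0,\ p(\mathbf u)=(\gamma-1)\Big(E-\tfrac12\rho(v_1^2+v_2^2)\Big)>0\Big\},$$ the corrected CU scheme described in the context is bound-preserving under the CFL condition $$\lambda^n\alpha_1+\mu^n\alpha_2\le\tfrac12,\quad\alpha_1:=\max_{j,k}\big\{\sigma^+_{j+\frac12,k}-\sigma^-_{j+\frac12,k}\big\},\quad\alpha_2:=\max_{j,k}\big\{\sigma^+_{j,k+\frac12}-\sigma^-_{j,k+\frac12}\big\}.$$ That is, if $\overline{\mathbf u}_{j,k}^{\,n}\in\mathcal G$ for all $j,k$ and the CFL condition holds, then $\overline{\mathbf u}_{j,k}^{\,n+1}\in\mathcal G$ for all $j,k$.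
   Context: 2-D Euler equations: $\mathbf u_t+\mathbf f(\mathbf u)_x+\mathbf g(\mathbf u)_y=\mathbf 0$ with $\mathbf u=(\rho,\rho v_1,\rho v_2,E)^\top$, $\mathbf f(\mathbf u)=(\rho v_1,\rho v_1^2+p,\rho v_1v_2,(E+p)v_1)^\top$, $\mathbf g(\mathbf u)=(\rho v_2,\rho v_1v_2,\rho v_2^2+p,(E+p)v_2)^\top$, $E=\frac12\rho(v_1^2+v_2^2)+\frac p{\gamma-1}$, constant $\gamma>1$, and sound speed $c=\sqrt{\gamma p/\rho}$. Write $p(\mathbf u)=(\gamma-1)\big(E-\frac12\rho(v_1^2+v_2^2)\big)$. Let $\Delta x,\Delta y,\Delta t^n>0$, $\lambda^n:=\Delta t^n/\Delta x$, $\mu^n:=\Delta t^n/\Delta y$; cell averages $\overline{\mathbf u}_{j,k}^{\,n}$, $j,k\in\mathbb Z$. $\mathrm{minmod}(c_1,c_2,\dots)$ equals $\min\{c_i\}$ if all $c_i>0$, $\max\{c_i\}$ if all $c_i<0$, and $0$ otherwise; it is applied componentwise. (1) Reconstruction. With $\theta\in[1,2]$, $$(\mathbf u_x)_{j,k}^n=\mathrm{minmod}\Big(\theta\tfrac{\overline{\mathbf u}_{j,k}^{\,n}-\overline{\mathbf u}_{j-1,k}^{\,n}}{\Delta x},\tfrac{\overline{\mathbf u}_{j+1,k}^{\,n}-\overline{\mathbf u}_{j-1,k}^{\,n}}{2\Delta x},\theta\tfrac{\overline{\mathbf u}_{j+1,k}^{\,n}-\overline{\mathbf u}_{j,k}^{\,n}}{\Delta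 x}\Big),$$ $$(\mathbf u_y)_{j,k}^n=\mathrm{minmod}\Big(\theta\tfrac{\overline{\mathbf u}_{j,k}^{\,n}-\overline{\mathbf u}_{j,k-1}^{\,n}}{\Delta y},\tfrac{\overline{\mathbf u}_{j,k+1}^{\,n}-\overline{\mathbf u}_{j,k-1}^{\,n}}{2\Delta y},\theta\tfrac{\overline{\mathbf u}_{j,k+1}^{\,n}-\overline{\mathbf u}_{j,k}^{\,n}}{\Delta y}\Big),$$ and $\mathbf u^-_{j+\frac12,k}=\overline{\mathbf u}_{j,k}^{\,n}+\frac{\Delta x}2(\mathbf u_x)_{j,k}^n$, $\mathbf u^+_{j+\frac12,k}=\overline{\mathbf u}_{j+1,k}^{\,n}-\frac{\Delta x}2(\mathbf u_x)_{j+1,k}^n$, $\mathbf u^-_{j,k+\frac12}=\overline{\mathbf u}_{j,k}^{\,n}+\frac{\Delta y}2(\mathbf u_y)_{j,k}^n$, $\mathbf u^+_{j,k+\frac12}=\overline{\mathbf u}_{j,k+1}^{\,n}-\frac{\Delta y}2(\mathbf u_y)_{j,k+1}^n$. (2) Limiting of point values. These values are replaced by $$\tilde{\mathbf u}^\mp_{j\pm\frac12,k}=(1-\delta^x_{j,k})\overline{\mathbf u}_{j,k}^{\,n}+\delta^x_{j,k}\mathbf u^\mp_{j\pm\frac12,k},\quad \tilde{\mathbf u}^\mp_{j,k\pm\frac12}=(1-\delta^y_{j,k})\overline{\mathbf u}_{j,k}^{\,n}+\delta^y_{j,k}\mathbf u^\mp_{j,k\pm\frac12},$$ $$\delta^x_{j,k}=\min\Big\{\tfrac{p(\overline{\mathbf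 u}_{j,k}^{\,n})-\hat\varepsilon_{j,k}}{p(\overline{\mathbf u}_{j,k}^{\,n})-\hat p^x_{j,k}},1\Big\},\quad \delta^y_{j,k}=\min\Big\{\tfrac{p(\overline{\mathbf u}_{j,k}^{\,n})-\hat\varepsilon_{j,k}}{p(\overline{\mathbf u}_{j,k}^{\,n})-\hat p^y_{j,k}},1\Big\},\quad \hat\varepsilon_{j,k}=\min\{10^{-13},p(\overline{\mathbf u}_{j,k}^{\,n})\},$$ $\hat p^x_{j,k}=\min\{p(\mathbf u^+_{j-\frac12,k}),p(\mathbf u^-_{j+\frac12,k})\}$, $\hat p^y_{j,k}=\min\{p(\mathbf u^+_{j,k-\frac12}),p(\mathbf u^-_{j,k+\frac12})\}$. From now on tildes are dropped: $\mathbf u^\pm_{j+\frac12,k},\mathbf u^\pm_{j,k+\frac12}$ denote the limited values, with components and derived quantities ($v_1,v_2,c$) labelled accordingly. (3) Speeds. $$\sigma^-_{j+\frac12,k}=\min\{(v_1)^-_{j+\frac12,k}-c^-_{j+\frac12,k},(v_1)^+_{j+\frac12,k}-c^+_{j+\frac12,k},0\},\quad \sigma^+_{j+\frac12,k}=\max\{(v_1)^-_{j+\frac12,k}+c^-_{j+\frac12,k},(v_1)^+_{j+\frac12,k}+c^+_{j+\frac12,k},0\},$$ $$\sigma^-_{j,k+\frac12}=\min\{(v_2)^-_{j,k+\frac12}-c^-_{j,k+\frac12},(v_2)^+_{j,k+\frac12}-c^+_{j,k+\frac12},0\},\quad \sigma^+_{j,k+\frac12}=\max\{(v_2)^-_{j,k+\frac12}+c^-_{j,k+\frac12},(v_2)^+_{j,k+\frac12}+c^+_{j,k+\frac12},0\};$$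 at any interface where $\sigma^+-\sigma^-<\varepsilon$ (a fixed small $\varepsilon>0$), they are replaced by $\sigma^\pm=\pm\varepsilon$. (4) Anti-diffusion. For $\mathbf h=\mathbf f$ or $\mathbf g$ (giving $R_h=R_f$ or $R_g$) let $R_h(\sigma^+,\sigma^-,\mathbf u^+,\mathbf u^-):=\frac{\sigma^+\mathbf u^+-\sigma^-\mathbf u^--\mathbf h(\mathbf u^+)+\mathbf h(\mathbf u^-)}{\sigma^+-\sigma^-}$. For each interface index $\iota$, with $\iota=(j+\frac12,k)$ using $R_f$ and $\iota=(j,k+\frac12)$ using $R_g$: $$\mathbf u^*_\iota=R(\sigma^+_\iota,\sigma^-_\iota,\mathbf u^+_\iota,\mathbf u^-_\iota),\quad \mathbf d_\iota=\mathrm{minmod}(\mathbf u^+_\iota-\mathbf u^*_\iota,\mathbf u^*_\iota-\mathbf u^-_\iota),\quad \mathbf u^{*,\pm}_\iota=\mathbf u^*_\iota-\tfrac{\sigma^\pm_\iota}{\sigma^+_\iota-\sigma^-_\iota}\mathbf d_\iota,$$ and $\mathbf d_\iota$ is replaced by $\tilde{\mathbf d}_\iota=\beta_\iota\mathbf d_\iota$ with $$\beta_\iota=\min\Big\{\tfrac{p(\mathbf u^*_\iota)-\hat\varepsilon_\iota}{p(\mathbf u^*_\iota)-\hat p_\iota},1\Big\},\quad \hat\varepsilon_\iota=\min\{10^{-13},p(\mathbf u^*_\iota)\},\quad \hat p_\iota=\min\{p(\mathbf u^{*,+}_\iota),p(\mathbf u^{*,-}_\iota)\}.$$ In (2) and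 (4), $\delta^x$, $\delta^y$ or $\beta$ is taken to be $1$ when the denominator in its definition vanishes. (5) Update. $$\overline{\mathbf u}^{\,n+1}_{j,k}=\overline{\mathbf u}^{\,n}_{j,k}-\lambda^n\big(\hat{\mathbf f}_{j+\frac12,k}-\hat{\mathbf f}_{j-\frac12,k}\big)-\mu^n\big(\hat{\mathbf g}_{j,k+\frac12}-\hat{\mathbf g}_{j,k-\frac12}\big),$$ where, for $\iota=(j+\frac12,k)$ and $\mathbf h=\mathbf f$, or $\iota=(j,k+\frac12)$ and $\mathbf h=\mathbf g$, $$\hat{\mathbf h}_\iota=\frac{\sigma^+_\iota\mathbf h(\mathbf u^-_\iota)-\sigma^-_\iota\mathbf h(\mathbf u^+_\iota)}{\sigma^+_\iota-\sigma^-_\iota}+\frac{\sigma^+_\iota\sigma^-_\iota}{\sigma^+_\iota-\sigma^-_\iota}\big(\mathbf u^+_\iota-\mathbf u^-_\iota-\tilde{\mathbf d}_\iota\big).$$ *)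

theory Defs
  imports "HOL-Analysis.Analysis"
begin

text \<open>
  A state of the 2-D Euler equations is the vector \<open>(\<rho>, \<rho> v\<^sub>1, \<rho> v\<^sub>2, E)\<close> of conserved
  variables, a point of \<open>real ^ 4\<close>. (In the index type \<open>4\<close> the indices are \<open>1, 2, 3\<close> and \<open>4 = 0\<close>.)
\<close>

definition rho :: "real ^ 4 \<Rightarrow> real" where
  "rho w = w $ 1"

definition vel1 :: "real ^ 4 \<Rightarrow> real" where
  "vel1 w = w $ 2 / w $ 1"

definition vel2 :: "real ^ 4 \<Rightarrow> real" where
  "vel2 w = w $ 3 / w $ 1"

definition energy :: "real ^ 4 \<Rightarrow> real" where
  "energy w = w $ 4"

definition pressure :: "real \<Rightarrow> real ^ 4 \<Rightarrow> real" where
  "pressure \<gamma> w = (\<gamma> - 1) * (energy w - 1 / 2 * rho w * ((vel1 w)\<^sup>2 + (vel2 w)\<^sup>2))"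

definition sound_speed :: "real \<Rightarrow> real ^ 4 \<Rightarrow> real" where
  "sound_speed \<gamma> w = sqrt (\<gamma> * pressure \<gamma> w / rho w)"

definition flux_f :: "real \<Rightarrow> real ^ 4 \<Rightarrow> real ^ 4" where
  "flux_f \<gamma> w = vector
    [rho w * vel1 w,
     rho w * (vel1 w)\<^sup>2 + pressure \<gamma> w,
     rho w * vel1 w * vel2 w,
     (energy w + pressure \<gamma> w) * vel1 w]"

definition flux_g :: "real \<Rightarrow> real ^ 4 \<Rightarrow> real ^ 4" where
  "flux_g \<gamma> w = vector
    [rho w * vel2 w,
     rho w * vel1 w * vel2 w,
     rho w * (vel2 w)\<^sup>2 + pressure \<gamma> w,
     (energy w + pressure \<gamma> w) * vel2 w]"

definition invariant_region :: "real \<Rightarrow> (real ^ 4) set" where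
  "invariant_region \<gamma> = {w. rho w > 0 \<and> pressure \<gamma> w > 0}"

definition minmod :: "real list \<Rightarrow> real" where
  "minmod cs =
    (if \<forall>c\<in>set cs. c > 0 then Min (set cs)
     else if \<forall>c\<in>set cs. c < 0 then Max (set cs)
     else 0)"

definition minmod_vec :: "(real ^ 4) list \<Rightarrow> real ^ 4" where
  "minmod_vec ws = (\<chi> i. minmod (map (\<lambda>w. w $ i) ws))"

text \<open>
  The coefficients \<open>\<delta>\<^sup>x\<close>, \<open>\<delta>\<^sup>y\<close> and \<open>\<beta>\<close> are all of the following form, where \<open>p\<close> is the pressure of
  the state towards which one limits and \<open>q\<close> is the smaller pressure of the two limited states.
\<close>

definition limiter_coeff :: "real \<Rightarrow> real \<Rightarrow> real" where
  "limiter_coeff p q =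
    (if p - q = 0 then 1 else min ((p - min (1 / 10 ^ 13) p) / (p - q)) 1)"

text \<open>
  Reconstruction, limiting, one-sided speeds, anti-diffusion and numerical flux only ever involve
  cells on one grid line. They are therefore defined once, for the cell averages \<open>a i\<close> along a line
  with mesh size \<open>d\<close>, flux \<open>h\<close> and normal velocity \<open>v\<close>. The \<open>x\<close>-direction is the instance
  \<open>h = f\<close>, \<open>v = v\<^sub>1\<close>, \<open>a = (\<lambda>j. u j k)\<close>, and the \<open>y\<close>-direction the instance
  \<open>h = g\<close>, \<open>v = v\<^sub>2\<close>, \<open>a = (\<lambda>k. u j k)\<close>. A quantity located at an interface has as argument \<open>i\<close> the
  cell to the left of (or below) it: index \<open>i\<close> stands for the interface \<open>i + 1/2\<close>.
\<close>

context
  fixes \<gamma> \<theta> \<epsilon> d :: real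
    and h :: "real ^ 4 \<Rightarrow> real ^ 4" and v :: "real ^ 4 \<Rightarrow> real"
    and a :: "int \<Rightarrow> real ^ 4"
begin

definition slope :: "int \<Rightarrow> real ^ 4" where
  "slope i = minmod_vec
    [\<theta> *\<^sub>R ((a i - a (i - 1)) /\<^sub>R d),
     (a (i + 1) - a (i - 1)) /\<^sub>R (2 * d),
     \<theta> *\<^sub>R ((a (i + 1) - a i) /\<^sub>R d)]"

definition recon_minus :: "int \<Rightarrow> real ^ 4" where
  "recon_minus i = a i + (d / 2) *\<^sub>R slope i"

definition recon_plus :: "int \<Rightarrow> real ^ 4" where
  "recon_plus i = a (i + 1) - (d / 2) *\<^sub>R slope (i + 1)"

definition delta :: "int \<Rightarrow> real" where
  "delta i = limiter_coeff (pressure \<gamma> (a i))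
     (min (pressure \<gamma> (recon_plus (i - 1))) (pressure \<gamma> (recon_minus i)))"

definition u_minus :: "int \<Rightarrow> real ^ 4" where
  "u_minus i = (1 - delta i) *\<^sub>R a i + delta i *\<^sub>R recon_minus i"

definition u_plus :: "int \<Rightarrow> real ^ 4" where
  "u_plus i = (1 - delta (i + 1)) *\<^sub>R a (i + 1) + delta (i + 1) *\<^sub>R recon_plus i"

definition sigma_minus_raw :: "int \<Rightarrow> real" where
  "sigma_minus_raw i = Min
    {v (u_minus i) - sound_speed \<gamma> (u_minus i), v (u_plus i) - sound_speed \<gamma> (u_plus i), 0}"

definition sigma_plus_raw :: "int \<Rightarrow> real" where
  "sigma_plus_raw i = Max
    {v (u_minus i) + sound_speed \<gamma> (u_minus i), v (u_plus i) + sound_speed \<gamma> (u_plus i), 0}"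

definition sigma_minus :: "int \<Rightarrow> real" where
  "sigma_minus i =
    (if sigma_plus_raw i - sigma_minus_raw i < \<epsilon> then - \<epsilon> else sigma_minus_raw i)"

definition sigma_plus :: "int \<Rightarrow> real" where
  "sigma_plus i =
    (if sigma_plus_raw i - sigma_minus_raw i < \<epsilon> then \<epsilon> else sigma_plus_raw i)"

definition u_star :: "int \<Rightarrow> real ^ 4" where
  "u_star i =
    (sigma_plus i *\<^sub>R u_plus i - sigma_minus i *\<^sub>R u_minus i - h (u_plus i) + h (u_minus i))
      /\<^sub>R (sigma_plus i - sigma_minus i)"

definition anti_diff :: "int \<Rightarrow> real ^ 4" where
  "anti_diff i = minmod_vec [u_plus i - u_star i, u_star i - u_minus i]"

definition u_star_plus :: "int \<Rightarrow> real ^ 4" where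
  "u_star_plus i =
    u_star i - (sigma_plus i / (sigma_plus i - sigma_minus i)) *\<^sub>R anti_diff i"

definition u_star_minus :: "int \<Rightarrow> real ^ 4" where
  "u_star_minus i =
    u_star i - (sigma_minus i / (sigma_plus i - sigma_minus i)) *\<^sub>R anti_diff i"

definition beta :: "int \<Rightarrow> real" where
  "beta i = limiter_coeff (pressure \<gamma> (u_star i))
     (min (pressure \<gamma> (u_star_plus i)) (pressure \<gamma> (u_star_minus i)))"

definition num_flux :: "int \<Rightarrow> real ^ 4" where
  "num_flux i =
    (sigma_plus i *\<^sub>R h (u_minus i) - sigma_minus i *\<^sub>R h (u_plus i))
      /\<^sub>R (sigma_plus i - sigma_minus i)
    + (sigma_plus i * sigma_minus i / (sigma_plus i - sigma_minus i)) *\<^sub>R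
        (u_plus i - u_minus i - beta i *\<^sub>R anti_diff i)"

end

text \<open>
  \<open>width_x \<dots> j k\<close> is \<open>\<sigma>\<^sup>+ - \<sigma>\<^sup>-\<close> at the interface \<open>(j + 1/2, k)\<close>, and \<open>width_y \<dots> j k\<close> is
  \<open>\<sigma>\<^sup>+ - \<sigma>\<^sup>-\<close> at the interface \<open>(j, k + 1/2)\<close>; likewise for the numerical fluxes.
\<close>

context
  fixes \<gamma> \<theta> \<epsilon> dx dy :: real and u :: "int \<Rightarrow> int \<Rightarrow> real ^ 4"
begin

definition width_x :: "int \<Rightarrow> int \<Rightarrow> real" where
  "width_x j k =
    sigma_plus \<gamma> \<theta> \<epsilon> dx vel1 (\<lambda>i. u i k) j - sigma_minus \<gamma> \<theta> \<epsilon> dx vel1 (\<lambda>i. u i k) j"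

definition width_y :: "int \<Rightarrow> int \<Rightarrow> real" where
  "width_y j k =
    sigma_plus \<gamma> \<theta> \<epsilon> dy vel2 (\<lambda>i. u j i) k - sigma_minus \<gamma> \<theta> \<epsilon> dy vel2 (\<lambda>i. u j i) k"

definition num_flux_f :: "int \<Rightarrow> int \<Rightarrow> real ^ 4" where
  "num_flux_f j k = num_flux \<gamma> \<theta> \<epsilon> dx (flux_f \<gamma>) vel1 (\<lambda>i. u i k) j"

definition num_flux_g :: "int \<Rightarrow> int \<Rightarrow> real ^ 4" where
  "num_flux_g j k = num_flux \<gamma> \<theta> \<epsilon> dy (flux_g \<gamma>) vel2 (\<lambda>i. u j i) k"

text \<open>
  The maxima range over the infinite grid, so they are taken as suprema in the extended reals; where
  the maximum exists it is this supremum, and no boundedness has to be presupposed.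
\<close>

definition alpha1 :: ereal where
  "alpha1 = (SUP (j, k) \<in> UNIV. ereal (width_x j k))"

definition alpha2 :: ereal where
  "alpha2 = (SUP (j, k) \<in> UNIV. ereal (width_y j k))"

definition cu_step :: "real \<Rightarrow> int \<Rightarrow> int \<Rightarrow> real ^ 4" where
  "cu_step dt j k =
    u j k - (dt / dx) *\<^sub>R (num_flux_f j k - num_flux_f (j - 1) k)
          - (dt / dy) *\<^sub>R (num_flux_g j k - num_flux_g j (k - 1))"

end

end

theory Submission
  imports Defs
begin

text \<open>
  The invariant region is an open convex cone on which the pressure is superadditive and positively
  homogeneous, hence concave. If \<open>s\<close> is at least \<open>v + c\<close>, then \<open>s u - h(u)\<close> lies in
  this cone, and so does \<open>h(u) - s u\<close> if \<open>s\<close> is at most \<open>v - c\<close>; in particular the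
  intermediate state \<open>u\<^sup>*\<close> is admissible. Since \<open>u\<^sup>*\<close> is a convex combination of
  \<open>u\<^sup>*\<^sup>,\<^sup>+\<close> and \<open>u\<^sup>*\<^sup>,\<^sup>-\<close>, and a cell average is the mean of its two point values,
  concavity keeps the limiting coefficients in \<open>[0, 1]\<close>, and the limited states are admissible.
  The numerical flux has the two representations
  \<open>h(u\<^sup>-) + \<sigma>\<^sup>- (u\<^sup>*\<^sup>,\<^sup>+ - u\<^sup>-) = h(u\<^sup>+) + \<sigma>\<^sup>+ (u\<^sup>*\<^sup>,\<^sup>- - u\<^sup>+)\<close>. Inserting the first at the right and
  the second at the left interface of a cell, and halving each cell average between its two point
  values, writes the update as a sum of elements of the cone: the CFL condition says exactly that
  the share of each point value pays for its flux.
\<close>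

section \<open>The cone of admissible states\<close>

lemma pressure_conserved:
  "pressure \<gamma> w = (\<gamma> - 1) * (w $ 4 - ((w $ 2)\<^sup>2 + (w $ 3)\<^sup>2) / (2 * w $ 1))"
  by (simp add: pressure_def energy_def rho_def vel1_def vel2_def power_divide
      power2_eq_square field_simps)

lemma pressure_scaleR: "pressure \<gamma> (t *\<^sub>R w) = t * pressure \<gamma> w"
  by (cases "t = 0") (simp_all add: pressure_def energy_def rho_def vel1_def vel2_def algebra_simps)

text \<open>Clearing the denominator removes \<gamma> and shows the region as an open rotated
  Lorentz cone, the form in which flux vectors are tested.\<close>

lemma invariant_region_iff:
  assumes "\<gamma> > 1"
  shows "w \<in> invariant_region \<gamma> \<longleftrightarrow> w $ 1 > 0 \<and> (w $ 2)\<^sup>2 + (w $ 3)\<^sup>2 < 2 * w $ 1 * w $ 4"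
proof -
  have "pressure \<gamma> w > 0 \<longleftrightarrow> ((w $ 2)\<^sup>2 + (w $ 3)\<^sup>2) / (2 * w $ 1) < w $ 4"
    using assms by (simp add: pressure_conserved zero_less_mult_iff)
  then show ?thesis
    by (auto simp: invariant_region_def rho_def pos_divide_less_eq mult.commute mult.left_commute)
qed

text \<open>Two-term Cauchy-Schwarz, with an explicit square as the gap; it makes the kinetic energy
  subadditive.\<close>

lemma square_div_subadditive:
  fixes m n r s :: real
  assumes "r > 0" "s > 0"
  shows "(m + n)\<^sup>2 / (r + s) \<le> m\<^sup>2 / r + n\<^sup>2 / s"
proof -
  have "m\<^sup>2 / r + n\<^sup>2 / s - (m + n)\<^sup>2 / (r + s) = (m * s - n * r)\<^sup>2 / (r * s * (r + s))"
    using assms by (simp add: divide_simps power2_eq_square) (simp add: algebra_simps)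
  also have "\<dots> \<ge> 0" using assms by simp
  finally show ?thesis by simp
qed

lemma pressure_superadditive:
  assumes "\<gamma> > 1" "w $ 1 > 0" "z $ 1 > 0"
  shows "pressure \<gamma> w + pressure \<gamma> z \<le> pressure \<gamma> (w + z)"
proof -
  define K where "K x = x $ 4 - ((x $ 2)\<^sup>2 + (x $ 3)\<^sup>2) / (2 * x $ 1)" for x :: "real ^ 4"
  have "K w + K z \<le> K (w + z)"
    using square_div_subadditive[of "2 * w $ 1" "2 * z $ 1" "w $ 2" "z $ 2"]
      square_div_subadditive[of "2 * w $ 1" "2 * z $ 1" "w $ 3" "z $ 3"] assms
    by (simp add: K_def add_divide_distrib distrib_left)
  then have "(\<gamma> - 1) * (K w + K z) \<le> (\<gamma> - 1) * K (w + z)"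
    using assms by simp
  then show ?thesis
    by (simp add: pressure_conserved K_def distrib_left)
qed

lemma pressure_concave:
  assumes "\<gamma> > 1" "w $ 1 > 0" "z $ 1 > 0" "0 \<le> t" "t \<le> 1"
  shows "(1 - t) * pressure \<gamma> w + t * pressure \<gamma> z \<le> pressure \<gamma> ((1 - t) *\<^sub>R w + t *\<^sub>R z)"
\<comment> \<open>At the endpoints one scaled state has density zero, outside the scope of
  superadditivity.\<close>
proof (cases "t = 0 \<or> t = 1")
  case False
  then show ?thesis
    using pressure_superadditive[of \<gamma> "(1 - t) *\<^sub>R w" "t *\<^sub>R z"] assms
    by (simp add: pressure_scaleR)
qed auto

lemma invariant_region_scaleR:
  assumes "w \<in> invariant_region \<gamma>" "t > 0"
  shows "t *\<^sub>R w \<in> invariant_region \<gamma>"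
  using assms by (simp add: invariant_region_def pressure_scaleR rho_def)

lemma invariant_region_add:
  assumes "\<gamma> > 1" "w \<in> invariant_region \<gamma>" "z \<in> invariant_region \<gamma>"
  shows "w + z \<in> invariant_region \<gamma>"
  using assms pressure_superadditive[of \<gamma> w z] by (simp add: invariant_region_def rho_def)

text \<open>Zero weights must be allowed: a one-sided speed vanishes in supersonic flow.\<close>

lemma invariant_region_add_scaleR:
  assumes "\<gamma> > 1" "w \<in> invariant_region \<gamma>" "z \<in> invariant_region \<gamma>" "0 \<le> t"
  shows "w + t *\<^sub>R z \<in> invariant_region \<gamma>"
proof (cases "t = 0")
  case False
  then show ?thesis
    using assms by (intro invariant_region_add invariant_region_scaleR) auto
qed (use assms in simp)

text \<open>By concavity the limited pressure is at least \<open>p - t * (p - q)\<close>, which the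
  coefficient keeps at or above the positive floor \<open>min (1 / 10 ^ 13) p\<close>. A mere lower
  bound \<open>q\<close> appears because the scheme uses the smaller pressure of two
  candidates.\<close>

lemma limited_state_in_invariant_region:
  assumes "\<gamma> > 1" "w \<in> invariant_region \<gamma>" "z $ 1 > 0"
    and q: "q \<le> pressure \<gamma> w" "q \<le> pressure \<gamma> z"
  defines "t \<equiv> limiter_coeff (pressure \<gamma> w) q"
  shows "(1 - t) *\<^sub>R w + t *\<^sub>R z \<in> invariant_region \<gamma>"
proof -
  define p where "p = pressure \<gamma> w"
  have p: "p > 0" and w1: "w $ 1 > 0"
    using assms(2) by (auto simp: invariant_region_def p_def rho_def)
  have t: "0 \<le> t" "t \<le> 1" and pt: "0 < p - t * (p - q)"
  proof -
    have "0 \<le> t \<and> t \<le> 1 \<and> t * (p - q) \<le> p - min (1 / 10 ^ 13) p"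
    proof (cases "p = q")
      case False
      then have pq: "p - q > 0" using q(1) by (simp add: p_def)
      have t_eq: "t = min ((p - min (1 / 10 ^ 13) p) / (p - q)) 1"
        using pq by (simp add: t_def limiter_coeff_def p_def)
      then have "t \<le> (p - min (1 / 10 ^ 13) p) / (p - q)" by simp
      then have "t * (p - q) \<le> p - min (1 / 10 ^ 13) p"
        using pq by (simp only: pos_le_divide_eq)
      moreover have "0 \<le> (p - min (1 / 10 ^ 13) p) / (p - q)"
        using pq by (intro divide_nonneg_pos) auto
      ultimately show ?thesis by (simp add: t_eq)
    qed (auto simp: t_def limiter_coeff_def p_def)
    moreover have "min (1 / 10 ^ 13) p > 0" using p by simp
    ultimately show "0 \<le> t" "t \<le> 1" "0 < p - t * (p - q)" by linarith+
  qed
  have "p - t * (p - q) = (1 - t) * p + t * q" by (simp add: algebra_simps)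
  also have "\<dots> \<le> (1 - t) * p + t * pressure \<gamma> z"
    using q(2) t(1) by (simp add: mult_left_mono)
  also have "\<dots> \<le> pressure \<gamma> ((1 - t) *\<^sub>R w + t *\<^sub>R z)"
    using pressure_concave[OF assms(1) w1 assms(3) t] by (simp add: p_def)
  finally have "0 < pressure \<gamma> ((1 - t) *\<^sub>R w + t *\<^sub>R z)" using pt by linarith
  moreover have "0 < (1 - t) * w $ 1 + t * z $ 1"
    using w1 assms(3) t by (cases "t = 0") (auto intro: add_nonneg_pos)
  ultimately show ?thesis by (simp add: invariant_region_def rho_def)
qed

lemma minmod_bounds:
  assumes "c \<in> set cs"
  shows "min 0 c \<le> minmod cs" "minmod cs \<le> max 0 c"
proof -
  have ne: "set cs \<noteq> {}" and M: "Min (set cs) \<le> c" "c \<le> Max (set cs)"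
    using assms by auto
  have "Min (set cs) \<in> set cs" "Max (set cs) \<in> set cs" using ne by auto
  with M assms show "min 0 c \<le> minmod cs" "minmod cs \<le> max 0 c"
    by (auto simp: minmod_def min_def max_def dest: less_imp_le)
qed

section \<open>Fluxes along a coordinate direction\<close>

text \<open>The two signs \<open>k = 1\<close> and \<open>k = -1\<close> give \<open>s w - h(w)\<close> and \<open>h(w) - s w\<close>.\<close>

lemma flux_cone_algebra:
  fixes r m n E p s \<gamma> :: real
  assumes "\<gamma> > 1" "r > 0" "p > 0" and p: "p = (\<gamma> - 1) * (E - (m\<^sup>2 + n\<^sup>2) / (2 * r))"
    and c: "sqrt (\<gamma> * p / r) \<le> k * (s - m / r)" and k: "k\<^sup>2 = 1"
  shows "0 < k * (s * r - m)"
    and "(k * (s * m - (m\<^sup>2 / r + p)))\<^sup>2 + (k * (s * n - m * n / r))\<^sup>2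
      < 2 * (k * (s * r - m)) * (k * (s * E - (E + p) * m / r))"
proof -
  \<comment> \<open>Speed relative to the fluid; in this variable the velocity cancels from the
    quadratic form below.\<close>
  define \<tau> where "\<tau> = s - m / r"
  have "0 < \<gamma> * p / r" using assms by simp
  then have c0: "0 < sqrt (\<gamma> * p / r)" by simp
  have "0 < r * (k * \<tau>)" using c c0 assms(2) mult_pos_pos[of r "k * \<tau>"] unfolding \<tau>_def by linarith
  also have "r * (k * \<tau>) = k * (s * r - m)"
    using assms(2) by (simp add: \<tau>_def field_simps)
  finally show "0 < k * (s * r - m)" .
  have "(sqrt (\<gamma> * p / r))\<^sup>2 \<le> (k * \<tau>)\<^sup>2"
    using c c0 by (intro power_mono) (auto simp: \<tau>_def)
  then have \<tau>: "\<gamma> * p / r \<le> \<tau>\<^sup>2"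
    using \<open>0 < \<gamma> * p / r\<close> by (simp add: power_mult_distrib k)
  have E: "E = p / (\<gamma> - 1) + (m\<^sup>2 + n\<^sup>2) / (2 * r)"
    using assms(1) p by (simp add: field_simps)
  define m' where "m' = m / r"
  define n' where "n' = n / r"
  have mn: "m = r * m'" "n = r * n'" using assms(2) by (simp_all add: m'_def n'_def)
  have s: "s = \<tau> + m'" by (simp add: \<tau>_def m'_def)
  have E': "E = p / (\<gamma> - 1) + r * (m'\<^sup>2 + n'\<^sup>2) / 2"
    using assms(2) unfolding E by (simp add: mn power2_eq_square field_simps)
  have quot: "m\<^sup>2 / r = r * m'\<^sup>2" "m * n / r = r * m' * n'" "(E + p) * m / r = (E + p) * m'"
    using assms(2) by (simp_all add: m'_def n'_def power2_eq_square)
  have "2 * (s * r - m) * (s * E - (E + p) * m / r)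
      - ((s * m - (m\<^sup>2 / r + p))\<^sup>2 + (s * n - m * n / r)\<^sup>2)
    = 2 * (r * \<tau>) * (\<tau> * E - p * m') - ((r * \<tau> * m' - p)\<^sup>2 + (r * \<tau> * n')\<^sup>2)"
    unfolding quot by (simp add: mn s power2_eq_square algebra_simps)
  also have "\<dots> = 2 * r * \<tau>\<^sup>2 * (E - r * (m'\<^sup>2 + n'\<^sup>2) / 2) - p\<^sup>2"
    by (simp add: power2_eq_square algebra_simps)
  also have "\<dots> = 2 * r * \<tau>\<^sup>2 * (p / (\<gamma> - 1)) - p\<^sup>2"
    by (simp add: E')
  also have "\<dots> > 0"
  proof -
    \<comment> \<open>The sound speed enters here and leaves the excess
      \<open>p\<^sup>2 * (\<gamma> + 1) / (\<gamma> - 1)\<close>.\<close>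
    have "r * \<tau>\<^sup>2 \<ge> \<gamma> * p" using \<tau> assms(2) by (simp add: field_simps)
    then have "2 * (r * \<tau>\<^sup>2) * (p / (\<gamma> - 1)) \<ge> 2 * (\<gamma> * p) * (p / (\<gamma> - 1))"
      using assms(1-3) by (intro mult_right_mono) auto
    moreover have "2 * (\<gamma> * p) * (p / (\<gamma> - 1)) - p\<^sup>2 = p\<^sup>2 * (\<gamma> + 1) / (\<gamma> - 1)"
      using assms by (simp add: field_simps power2_eq_square)
    moreover have "0 < p\<^sup>2 * (\<gamma> + 1) / (\<gamma> - 1)" using assms(1,3) by simp
    ultimately show ?thesis by (simp add: mult.assoc)
  qed
  finally have *: "(s * m - (m\<^sup>2 / r + p))\<^sup>2 + (s * n - m * n / r)\<^sup>2
      < 2 * (s * r - m) * (s * E - (E + p) * m / r)" by simp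
  \<comment> \<open>The cone inequality is quadratic, so the sign \<open>k\<close> drops out of
    it.\<close>
  have kk: "2 * (k * x) * (k * y) = 2 * x * y" for x y
  proof -
    have "2 * (k * x) * (k * y) = k\<^sup>2 * (2 * x * y)" by (simp add: power2_eq_square)
    then show ?thesis by (simp add: k)
  qed
  show "(k * (s * m - (m\<^sup>2 / r + p)))\<^sup>2 + (k * (s * n - m * n / r))\<^sup>2
      < 2 * (k * (s * r - m)) * (k * (s * E - (E + p) * m / r))"
    unfolding kk using * by (simp add: power_mult_distrib k)
qed

lemma vector_4_nth [simp]:
  "(vector [x, y, z, t] :: real ^ 4) $ 1 = x"
  "(vector [x, y, z, t] :: real ^ 4) $ 2 = y"
  "(vector [x, y, z, t] :: real ^ 4) $ 3 = z"
  "(vector [x, y, z, t] :: real ^ 4) $ 4 = t"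
  unfolding vector_def by auto

lemma flux_f_cone:
  assumes "\<gamma> > 1" and w: "w \<in> invariant_region \<gamma>"
    and c: "sound_speed \<gamma> w \<le> k * (s - vel1 w)" and k: "k\<^sup>2 = 1"
  shows "k *\<^sub>R (s *\<^sub>R w - flux_f \<gamma> w) \<in> invariant_region \<gamma>"
proof -
  have r: "w $ 1 > 0" "pressure \<gamma> w > 0" using w by (auto simp: invariant_region_def rho_def)
  note * = flux_cone_algebra[OF assms(1) r pressure_conserved
      c[unfolded sound_speed_def vel1_def rho_def] k]
  show ?thesis
    unfolding invariant_region_iff[OF assms(1)]
    using * r
    by (simp add: flux_f_def rho_def vel1_def vel2_def energy_def power2_eq_square)
qed

lemma flux_g_cone:
  assumes "\<gamma> > 1" and w: "w \<in> invariant_region \<gamma>"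
    and c: "sound_speed \<gamma> w \<le> k * (s - vel2 w)" and k: "k\<^sup>2 = 1"
  shows "k *\<^sub>R (s *\<^sub>R w - flux_g \<gamma> w) \<in> invariant_region \<gamma>"
proof -
  have r: "w $ 1 > 0" "pressure \<gamma> w > 0" using w by (auto simp: invariant_region_def rho_def)
  \<comment> \<open>The algebraic lemma takes the normal momentum first, so the two momenta are
    interchanged.\<close>
  have p: "pressure \<gamma> w = (\<gamma> - 1) * (w $ 4 - ((w $ 3)\<^sup>2 + (w $ 2)\<^sup>2) / (2 * w $ 1))"
    by (simp add: pressure_conserved add.commute)
  note * = flux_cone_algebra[OF assms(1) r p c[unfolded sound_speed_def vel2_def rho_def] k]
  show ?thesis
    unfolding invariant_region_iff[OF assms(1)]
    using * r
    by (simp add: flux_g_def rho_def vel1_def vel2_def energy_def power2_eq_square ac_simps)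
qed

section \<open>The scheme along a grid line\<close>

text \<open>Both directions are instances. All that is kept of the flux is its cone property, with
  \<open>k\<^sup>2 = 1\<close> encoding the two signs.\<close>

locale grid_line =
  fixes \<gamma> \<theta> \<epsilon> d :: real
    and h :: "real ^ 4 \<Rightarrow> real ^ 4" and v :: "real ^ 4 \<Rightarrow> real" and a :: "int \<Rightarrow> real ^ 4"
  assumes \<gamma>: "\<gamma> > 1" and \<theta>: "\<theta> \<in> {1..2}" and \<epsilon>: "\<epsilon> > 0" and d: "d > 0"
    and a: "a i \<in> invariant_region \<gamma>"
    and h: "\<lbrakk>w \<in> invariant_region \<gamma>; sound_speed \<gamma> w \<le> k * (s - v w); k\<^sup>2 = 1\<rbrakk>
      \<Longrightarrow> k *\<^sub>R (s *\<^sub>R w - h w) \<in> invariant_region \<gamma>"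
begin

abbreviation "G \<equiv> invariant_region \<gamma>"
abbreviation "slp \<equiv> slope \<theta> d a"
abbreviation "rm \<equiv> recon_minus \<theta> d a"
abbreviation "rp \<equiv> recon_plus \<theta> d a"
abbreviation "um \<equiv> u_minus \<gamma> \<theta> d a"
abbreviation "up \<equiv> u_plus \<gamma> \<theta> d a"
abbreviation "sm \<equiv> sigma_minus \<gamma> \<theta> \<epsilon> d v a"
abbreviation "sp \<equiv> sigma_plus \<gamma> \<theta> \<epsilon> d v a"
abbreviation "us \<equiv> u_star \<gamma> \<theta> \<epsilon> d h v a"
abbreviation "ad \<equiv> anti_diff \<gamma> \<theta> \<epsilon> d h v a"
abbreviation "usp \<equiv> u_star_plus \<gamma> \<theta> \<epsilon> d h v a"
abbreviation "usm \<equiv> u_star_minus \<gamma> \<theta> \<epsilon> d h v a"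
abbreviation "bt \<equiv> beta \<gamma> \<theta> \<epsilon> d h v a"
abbreviation "flx \<equiv> num_flux \<gamma> \<theta> \<epsilon> d h v a"

lemma G_density_pos: "w \<in> G \<Longrightarrow> w $ 1 > 0"
  by (simp add: invariant_region_def rho_def)

lemma flux_cone_upper: "\<lbrakk>w \<in> G; v w + sound_speed \<gamma> w \<le> s\<rbrakk> \<Longrightarrow> s *\<^sub>R w - h w \<in> G"
  using h[of w 1 s] by simp

lemma flux_cone_lower: "\<lbrakk>w \<in> G; s \<le> v w - sound_speed \<gamma> w\<rbrakk> \<Longrightarrow> h w - s *\<^sub>R w \<in> G"
  using h[of w "-1" s] by simp

section \<open>Reconstructed and limited point values\<close>

text \<open>If a point density falls below the average, minmod bounds the drop by \<theta> / 2 times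
  the difference to the neighbour on that side; for \<theta> \<le> 2 this leaves at least a convex
  combination of positive densities. \<open>rp (i - 1)\<close> is the left point value of cell
  \<open>i\<close>.\<close>

lemma recon_density_pos: "rm i $ 1 > 0" "rp (i - 1) $ 1 > 0"
proof -
  have pos: "a i $ 1 > 0" "a (i - 1) $ 1 > 0" "a (i + 1) $ 1 > 0"
    using a G_density_pos by blast+
  let ?s = "slp i $ 1"
  let ?L = "\<theta> * (inverse d * (a i $ 1 - a (i - 1) $ 1))"
    and ?R = "\<theta> * (inverse d * (a (i + 1) $ 1 - a i $ 1))"
  have cone: "x + \<theta> / 2 * (y - x) > 0" if "x > 0" "y > 0" for x y :: real
  proof -
    have "x + \<theta> / 2 * (y - x) = (1 - \<theta> / 2) * x + \<theta> / 2 * y"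
      by (simp add: algebra_simps add_divide_distrib diff_divide_distrib)
    also have "\<dots> > 0" using that \<theta> by (intro add_nonneg_pos) auto
    finally show ?thesis .
  qed
  have s: "?s \<le> max 0 ?L" "min 0 ?R \<le> ?s"
    unfolding slope_def minmod_vec_def vec_lambda_beta
    by (intro minmod_bounds; simp)+
  have "d / 2 * ?s \<le> max 0 (d / 2 * ?L)"
    using mult_left_mono[OF s(1), of "d / 2"] d by (simp add: max_mult_distrib_left)
  also have "d / 2 * ?L = \<theta> / 2 * (a i $ 1 - a (i - 1) $ 1)" using d by (simp add: field_simps)
  finally show "rp (i - 1) $ 1 > 0"
    using cone[OF pos(1,2)] pos(1) by (simp add: recon_plus_def algebra_simps max_def split: if_splits)
  have "min 0 (d / 2 * ?R) \<le> d / 2 * ?s"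
    using mult_left_mono[OF s(2), of "d / 2"] d by (simp add: min_mult_distrib_left)
  moreover have "d / 2 * ?R = \<theta> / 2 * (a (i + 1) $ 1 - a i $ 1)" using d by (simp add: field_simps)
  ultimately show "rm i $ 1 > 0"
    using cone[OF pos(1,3)] pos(1) by (simp add: recon_minus_def algebra_simps min_def split: if_splits)
qed

text \<open>Concavity at the midpoint; it makes the denominator in \<open>delta\<close>
  nonnegative.\<close>

lemma recon_pressure_le:
  "min (pressure \<gamma> (rp (i - 1))) (pressure \<gamma> (rm i)) \<le> pressure \<gamma> (a i)"
proof -
  have "(1 - 1 / 2) * pressure \<gamma> (rp (i - 1)) + 1 / 2 * pressure \<gamma> (rm i)
      \<le> pressure \<gamma> ((1 - 1 / 2) *\<^sub>R rp (i - 1) + (1 / 2) *\<^sub>R rm i)"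
    by (intro pressure_concave \<gamma> recon_density_pos) auto
  also have "(1 - 1 / 2) *\<^sub>R rp (i - 1) + (1 / 2) *\<^sub>R rm i = a i"
    by (simp add: vec_eq_iff recon_plus_def recon_minus_def algebra_simps)
  finally show ?thesis by (auto simp: min_def)
qed

lemma um_in_G: "um i \<in> G"
  unfolding u_minus_def delta_def
  by (intro limited_state_in_invariant_region \<gamma> a recon_density_pos recon_pressure_le) simp

lemma up_in_G: "up i \<in> G"
  using limited_state_in_invariant_region[OF \<gamma> a[of "i + 1"], of "rp i",
      OF _ recon_pressure_le[of "i + 1"]] recon_density_pos(2)[of "i + 1"]
  by (simp add: u_plus_def delta_def)

text \<open>The opposite slope corrections cancel because both point values of a cell share the
  coefficient \<open>delta i\<close>.\<close>

lemma cell_average: "a i = (1 / 2) *\<^sub>R (up (i - 1) + um i)"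
  by (simp add: vec_eq_iff u_plus_def u_minus_def recon_plus_def recon_minus_def field_simps)

text \<open>
  Replacing the speeds by \<open>\<plusminus>\<epsilon>\<close> only enlarges them in modulus, because
  \<open>\<sigma>\<^sup>- \<le> 0 \<le> \<sigma>\<^sup>+\<close> and the replacement happens only if \<open>\<sigma>\<^sup>+ - \<sigma>\<^sup>- < \<epsilon>\<close>.
\<close>

lemma speed_bounds:
  "sm i \<le> 0" "0 \<le> sp i" "sm i < sp i"
  "sm i \<le> v (um i) - sound_speed \<gamma> (um i)" "sm i \<le> v (up i) - sound_speed \<gamma> (up i)"
  "v (um i) + sound_speed \<gamma> (um i) \<le> sp i" "v (up i) + sound_speed \<gamma> (up i) \<le> sp i"
  using \<epsilon> by (auto simp: sigma_minus_def sigma_plus_def sigma_minus_raw_def sigma_plus_raw_def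
      min_def max_def split: if_splits)

section \<open>Intermediate state and limited anti-diffusion\<close>

lemma us_in_G: "us i \<in> G"
proof -
  have "(sp i *\<^sub>R up i - h (up i)) + (h (um i) - sm i *\<^sub>R um i) \<in> G"
    by (intro invariant_region_add \<gamma> flux_cone_upper flux_cone_lower um_in_G up_in_G speed_bounds)
  then show ?thesis
    unfolding u_star_def
    using invariant_region_scaleR[of _ \<gamma> "inverse (sp i - sm i)"] speed_bounds(3)[of i]
    by (simp add: add_diff_eq diff_add_eq diff_diff_eq2 diff_diff_eq ac_simps)
qed

text \<open>Only a fraction of \<open>ad i\<close> is applied, so minmod keeps the density of
  \<open>usp i\<close> at least the smaller of those of \<open>us i\<close> and \<open>um i\<close>,
  and likewise \<open>usm i\<close> with \<open>up i\<close>.\<close>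

lemma star_density_pos: "usp i $ 1 > 0" "usm i $ 1 > 0"
proof -
  define k where "k = sp i / (sp i - sm i)"
  define l where "l = - sm i / (sp i - sm i)"
  have kl: "0 \<le> k" "k \<le> 1" "0 \<le> l" "l \<le> 1"
    using speed_bounds(1-3)[of i] by (auto simp: k_def l_def divide_simps)
  have pos: "us i $ 1 > 0" "um i $ 1 > 0" "up i $ 1 > 0"
    using us_in_G um_in_G up_in_G G_density_pos by blast+
  let ?D = "ad i $ 1"
  have D: "?D \<le> max 0 (us i $ 1 - um i $ 1)" "min 0 (up i $ 1 - us i $ 1) \<le> ?D"
    unfolding anti_diff_def minmod_vec_def vec_lambda_beta
    by (intro minmod_bounds; simp)+
  have "k * ?D \<le> 1 * max 0 (us i $ 1 - um i $ 1)"
    using mult_left_mono[OF D(1) kl(1)] mult_right_mono[OF kl(2), of "max 0 (us i $ 1 - um i $ 1)"]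
    by simp
  then show "usp i $ 1 > 0"
    using pos by (simp add: u_star_plus_def k_def max_def split: if_splits)
  have "1 * min 0 (up i $ 1 - us i $ 1) \<le> l * ?D"
    using mult_left_mono[OF D(2) kl(3)]
      mult_right_mono_neg[OF kl(4), of "min 0 (up i $ 1 - us i $ 1)"]
    by simp
  then show "usm i $ 1 > 0"
    using pos by (simp add: u_star_minus_def l_def min_def split: if_splits)
qed

text \<open>The shifts from \<open>us i\<close> are \<open>- k\<close> and \<open>1 - k\<close>
  times \<open>ad i\<close>; the crossed weights \<open>1 - k\<close> and \<open>k\<close> cancel
  them, and concavity applies.\<close>

lemma star_pressure_le: "min (pressure \<gamma> (usp i)) (pressure \<gamma> (usm i)) \<le> pressure \<gamma> (us i)"
proof -
  define k where "k = sp i / (sp i - sm i)"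
  have k: "0 \<le> k" "k \<le> 1" and k': "sm i / (sp i - sm i) = k - 1"
    using speed_bounds(1-3)[of i] by (auto simp: k_def divide_simps)
  let ?m = "min (pressure \<gamma> (usp i)) (pressure \<gamma> (usm i))"
  have "?m = (1 - k) * ?m + k * ?m" by (simp add: algebra_simps)
  also have "\<dots> \<le> (1 - k) * pressure \<gamma> (usp i) + k * pressure \<gamma> (usm i)"
    using k by (intro add_mono mult_left_mono) auto
  also have "\<dots> \<le> pressure \<gamma> ((1 - k) *\<^sub>R usp i + k *\<^sub>R usm i)"
    by (intro pressure_concave \<gamma> star_density_pos k)
  also have "(1 - k) *\<^sub>R usp i + k *\<^sub>R usm i = us i"
    unfolding u_star_plus_def u_star_minus_def k' k_def[symmetric]
    by (simp add: vec_eq_iff algebra_simps)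
  finally show ?thesis .
qed

lemma limited_star_in_G:
  "us i - (bt i * sp i / (sp i - sm i)) *\<^sub>R ad i \<in> G"
  "us i - (bt i * sm i / (sp i - sm i)) *\<^sub>R ad i \<in> G"
proof -
  have "(1 - bt i) *\<^sub>R us i + bt i *\<^sub>R usp i \<in> G" "(1 - bt i) *\<^sub>R us i + bt i *\<^sub>R usm i \<in> G"
    unfolding beta_def
    by (intro limited_state_in_invariant_region \<gamma> us_in_G star_density_pos star_pressure_le; simp)+
  then show "us i - (bt i * sp i / (sp i - sm i)) *\<^sub>R ad i \<in> G"
    "us i - (bt i * sm i / (sp i - sm i)) *\<^sub>R ad i \<in> G"
    by (simp_all add: u_star_plus_def u_star_minus_def algebra_simps)
qed

section \<open>Flux representations and the update in one direction\<close>

text \<open>A jump relation across the wave of speed \<open>sm i\<close>. Factoring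
  \<open>sm i\<close> out of the product of speeds in the flux leaves \<open>sp i\<close> on the
  anti-diffusion.\<close>

lemma num_flux_left:
  "flx i = h (um i) + sm i *\<^sub>R (us i - (bt i * sp i / (sp i - sm i)) *\<^sub>R ad i - um i)"
proof -
  define q where "q = inverse (sp i - sm i)"
  have q: "q * (sp i - sm i) - 1 = 0" using speed_bounds(3)[of i] by (simp add: q_def)
  have "flx i - (h (um i) + sm i *\<^sub>R (us i - (bt i * sp i / (sp i - sm i)) *\<^sub>R ad i - um i))
      = (q * (sp i - sm i) - 1) *\<^sub>R (h (um i) - sm i *\<^sub>R um i)"
    unfolding num_flux_def u_star_def divide_inverse q_def[symmetric]
    by (simp add: algebra_simps)
  then show ?thesis unfolding q by simp
qed

lemma num_flux_right:
  "flx i = h (up i) + sp i *\<^sub>R (us i - (bt i * sm i / (sp i - sm i)) *\<^sub>R ad i - up i)"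
proof -
  define q where "q = inverse (sp i - sm i)"
  have q: "q * (sp i - sm i) - 1 = 0" using speed_bounds(3)[of i] by (simp add: q_def)
  have "flx i - (h (up i) + sp i *\<^sub>R (us i - (bt i * sm i / (sp i - sm i)) *\<^sub>R ad i - up i))
      = (q * (sp i - sm i) - 1) *\<^sub>R (h (up i) - sp i *\<^sub>R up i)"
    unfolding num_flux_def u_star_def divide_inverse q_def[symmetric]
    by (simp add: algebra_simps)
  then show ?thesis unfolding q by simp
qed

text \<open>\<open>2 * w\<close> is the portion of the cell average granted to this direction;
  keeping \<open>w\<close> free lets two directions share one average.\<close>

lemma line_update_in_G:
  assumes l: "l > 0" and w: "l * (sp i - sm i) \<le> w" "l * (sp (i - 1) - sm (i - 1)) \<le> w"
  shows "(2 * w) *\<^sub>R a i - l *\<^sub>R (flx i - flx (i - 1)) \<in> G"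
proof -
  let ?R = "us i - (bt i * sp i / (sp i - sm i)) *\<^sub>R ad i"
  let ?L = "us (i - 1) - (bt (i - 1) * sm (i - 1) / (sp (i - 1) - sm (i - 1))) *\<^sub>R ad (i - 1)"
  \<comment> \<open>What remains of each share after paying for its flux, divided by
    \<open>l\<close>. The bounds on \<open>w\<close> put the effective speed at or above
    \<open>sp i\<close> in \<open>?A\<close>, and at or below \<open>sm (i - 1)\<close> in
    \<open>?B\<close>.\<close>
  let ?A = "(w / l + sm i) *\<^sub>R um i - h (um i)"
  let ?B = "h (up (i - 1)) - (sp (i - 1) - w / l) *\<^sub>R up (i - 1)"
  have wl: "sp i \<le> w / l + sm i" "sp (i - 1) - w / l \<le> sm (i - 1)"
    using l w by (simp_all add: field_simps)
  have A: "?A \<in> G"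
    using wl(1) speed_bounds(6)[of i] by (intro flux_cone_upper um_in_G) linarith
  have B: "?B \<in> G"
    using wl(2) speed_bounds(5)[of "i - 1"] by (intro flux_cone_lower up_in_G) linarith
  have "l *\<^sub>R (?A + ?B + (- sm i) *\<^sub>R ?R + sp (i - 1) *\<^sub>R ?L) \<in> G"
    using speed_bounds(1,2)
    by (intro invariant_region_scaleR invariant_region_add_scaleR invariant_region_add \<gamma> l A B
        limited_star_in_G) auto
  also have "l *\<^sub>R (?A + ?B + (- sm i) *\<^sub>R ?R + sp (i - 1) *\<^sub>R ?L)
      = (2 * w) *\<^sub>R a i - l *\<^sub>R (flx i - flx (i - 1))"
    unfolding num_flux_left[of i] num_flux_right[of "i - 1"] cell_average[of i]
    using l by (simp add: vec_eq_iff algebra_simps)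
  finally show ?thesis .
qed

end

section \<open>Splitting the cell average between the two directions\<close>

theorem theorem3p2:
  fixes \<gamma> \<theta> \<epsilon> dx dy dt :: real and u :: "int \<Rightarrow> int \<Rightarrow> real ^ 4"
  assumes "\<gamma> > 1"
    and "\<theta> \<in> {1..2}"
    and "\<epsilon> > 0"
    and "dx > 0" and "dy > 0" and "dt > 0"
    and "\<And>j k. u j k \<in> invariant_region \<gamma>"
    and "ereal (dt / dx) * alpha1 \<gamma> \<theta> \<epsilon> dx u + ereal (dt / dy) * alpha2 \<gamma> \<theta> \<epsilon> dy u \<le> ereal (1 / 2)"
  shows "\<forall>j k. cu_step \<gamma> \<theta> \<epsilon> dx dy u dt j k \<in> invariant_region \<gamma>"
proof (intro allI)
  fix j k
  interpret x: grid_line \<gamma> \<theta> \<epsilon> dx "flux_f \<gamma>" vel1 "\<lambda>i. u i k"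
    using assms flux_f_cone by unfold_locales auto
  interpret y: grid_line \<gamma> \<theta> \<epsilon> dy "flux_g \<gamma>" vel2 "\<lambda>i. u j i"
    using assms flux_g_cone by unfold_locales auto
  let ?W = "\<lambda>i. width_x \<gamma> \<theta> \<epsilon> dx u i k" and ?H = "\<lambda>i. width_y \<gamma> \<theta> \<epsilon> dy u j i"
  define l where "l = dt / dx"
  define m where "m = dt / dy"
  have lm: "l > 0" "m > 0" using assms by (simp_all add: l_def m_def)
  \<comment> \<open>The larger demand of the two x-interfaces of this cell. Taking no more leaves
    \<open>1 / 2 - w\<close> for y, enough by \<open>cfl\<close> whichever interface attains the
    maximum.\<close>
  define w where "w = l * max (?W j) (?W (j - 1))"
  have cfl: "l * ?W i + m * ?H i' \<le> 1 / 2" for i i'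
  proof -
    \<comment> \<open>Monotonicity in the extended reals turns the bound on suprema into a real
      inequality for each pair of interfaces.\<close>
    have "ereal (?W i) \<le> alpha1 \<gamma> \<theta> \<epsilon> dx u"
      unfolding alpha1_def by (rule SUP_upper2[of "(i, k)"]) auto
    moreover have "ereal (?H i') \<le> alpha2 \<gamma> \<theta> \<epsilon> dy u"
      unfolding alpha2_def by (rule SUP_upper2[of "(j, i')"]) auto
    ultimately have "ereal l * ereal (?W i) + ereal m * ereal (?H i')
        \<le> ereal (dt / dx) * alpha1 \<gamma> \<theta> \<epsilon> dx u + ereal (dt / dy) * alpha2 \<gamma> \<theta> \<epsilon> dy u"
      unfolding l_def[symmetric] m_def[symmetric]
      using lm by (intro add_mono ereal_mult_left_mono) auto
    also note assms(8)
    finally show ?thesis by simp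
  qed
  have "l * ?W i \<le> w" if "i \<in> {j, j - 1}" for i
    using that lm by (auto simp: w_def)
  then have X: "(2 * w) *\<^sub>R u j k - l *\<^sub>R (num_flux_f \<gamma> \<theta> \<epsilon> dx u j k - num_flux_f \<gamma> \<theta> \<epsilon> dx u (j - 1) k)
      \<in> invariant_region \<gamma>"
    using x.line_update_in_G[OF lm(1), of j w] by (simp add: width_x_def num_flux_f_def)
  have "m * ?H i' \<le> 1 / 2 - w" for i'
    using cfl[of j i'] cfl[of "j - 1" i'] by (simp add: w_def max_def)
  then have Y: "(2 * (1 / 2 - w)) *\<^sub>R u j k
      - m *\<^sub>R (num_flux_g \<gamma> \<theta> \<epsilon> dy u j k - num_flux_g \<gamma> \<theta> \<epsilon> dy u j (k - 1)) \<in> invariant_region \<gamma>"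
    using y.line_update_in_G[OF lm(2), of k "1 / 2 - w"]
    unfolding width_y_def num_flux_g_def by blast
  show "cu_step \<gamma> \<theta> \<epsilon> dx dy u dt j k \<in> invariant_region \<gamma>"
    \<comment> \<open>The portions \<open>2 * w\<close> and \<open>2 * (1 / 2 - w)\<close> add up to
      the whole average.\<close>
    using invariant_region_add[OF assms(1) X Y]
    unfolding cu_step_def l_def[symmetric] m_def[symmetric]
    by (simp add: algebra_simps)
qed

end
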